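(* Let $X$ be a non-empty set, let $\mathcal X=\{0,1\}^X\setminus\{f_0\}$ where $f_0$ is the zero map, let $\Omega=\{(f,x): f\in\mathcal X,\ x\in X,\ f(x)=1\}$, and let $\mathbf S_\Omega$ be the left-handed skew Boolean algebra of all subsets of $\Omega$ with the operations $\wedge,\vee,\setminus$ and zero $\varnothing$ described in the context. Define $i\colon X\to\mathbf S_\Omega$ by $i(x)=\{(f,x): f\in\mathcal X,\ f(x)=1\}$, let $\overline X=\{i(x):x\in X\}$, and let $\mathbf S_X=\langle\overline X\rangle$ be the subalgebra of $\mathbf S_\Omega$ generated by $\overline X$. Then $\mathbf S_X$ is freely generated by $\overline X$ (as a left-handed skew Boolean algebra).
   Context: A skew lattice is an algebra $(S;\wedge,\vee)$ with associative binary operations satisfying $x\wedge(x\vee y)=x=(y\vee x)\wedge x$ and $x\vee(x\wedge y)=x=(y\wedge x)\vee x$. A skew Boolean algebra is an algebra $(S;\wedge,\vee,\setminus,0)$ such that $(S;\wedge,\vee)$ is a skew lattice satisfying $x\wedge(y\vee z)=(x\wedge y)\vee(x\wedge z)$ and $(x\vee y)\wedge z=(x\wedge z)\vee(y\wedge z)$, $0$ satisfies $0\wedge x=0=x\wedge 0$ and $0\vee x=x=x\vee 0$, and $(x\wedge y\wedge x)\vee(x\setminus y)=x$, $(x\wedge y\wedge x)\wedge(x\setminus y)=0=(x\setminus y)\wedge(x\wedge y\wedge x)$. It is left-handed if $x\wedge y\wedge x=x\wedge y$ and $x\vee y\vee x=y\vee x$ hold. Left-handed skew Boolean algebras form a variety;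 $\mathbf A$ in it is freely generated by $X\subseteq A$ if every map from $X$ to a left-handed skew Boolean algebra $\mathbf B$ extends uniquely to a homomorphism $\mathbf A\to\mathbf B$. Let $p\colon\Omega\to\mathcal X$, $p(f,x)=f$. The operations on subsets $A,B$ of $\Omega$ are: $A\wedge B=\{(f,x)\in A: f\in p(A)\cap p(B)\}$; $A\setminus B=\{(f,x)\in A: f\in p(A)\setminus p(B)\}$ (where $p(A)\setminus p(B)$ is the set difference); $A\vee B=(A\setminus B)\cup B$, with $A\setminus B$ the operation just defined. With these, $(\mathbf S_\Omega;\wedge,\vee,\setminus,\varnothing)$ is a left-handed skew Boolean algebra. *)

theory Defs
  imports "HOL-Algebra.Congruence" "HOL-Library.FuncSet"
begin

record 'a skew_algebra = "'a partial_object" +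
  sk_meet :: "'a \<Rightarrow> 'a \<Rightarrow> 'a" (infixl "\<curlywedge>\<index>" 70)
  sk_join :: "'a \<Rightarrow> 'a \<Rightarrow> 'a" (infixl "\<curlyvee>\<index>" 65)
  sk_diff :: "'a \<Rightarrow> 'a \<Rightarrow> 'a" (infixl "\<setminus>\<index>" 70)
  sk_zero :: "'a" ("\<zero>\<index>")

locale skew_lattice =
  fixes S :: "('a, 'm) skew_algebra_scheme" (structure)
  assumes meet_closed: "\<lbrakk>x \<in> carrier S; y \<in> carrier S\<rbrakk> \<Longrightarrow> x \<curlywedge> y \<in> carrier S"
    and join_closed: "\<lbrakk>x \<in> carrier S; y \<in> carrier S\<rbrakk> \<Longrightarrow> x \<curlyvee> y \<in> carrier S"
    and meet_assoc: "\<lbrakk>x \<in> carrier S; y \<in> carrier S; z \<in> carrier S\<rbrakk>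
      \<Longrightarrow> (x \<curlywedge> y) \<curlywedge> z = x \<curlywedge> (y \<curlywedge> z)"
    and join_assoc: "\<lbrakk>x \<in> carrier S; y \<in> carrier S; z \<in> carrier S\<rbrakk>
      \<Longrightarrow> (x \<curlyvee> y) \<curlyvee> z = x \<curlyvee> (y \<curlyvee> z)"
    and meet_absorb_left: "\<lbrakk>x \<in> carrier S; y \<in> carrier S\<rbrakk> \<Longrightarrow> x \<curlywedge> (x \<curlyvee> y) = x"
    and meet_absorb_right: "\<lbrakk>x \<in> carrier S; y \<in> carrier S\<rbrakk> \<Longrightarrow> (y \<curlyvee> x) \<curlywedge> x = x"
    and join_absorb_left: "\<lbrakk>x \<in> carrier S; y \<in> carrier S\<rbrakk> \<Longrightarrow> x \<curlyvee> (x \<curlywedge> y) = x"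
    and join_absorb_right: "\<lbrakk>x \<in> carrier S; y \<in> carrier S\<rbrakk> \<Longrightarrow> (y \<curlywedge> x) \<curlyvee> x = x"

locale skew_boolean_algebra = skew_lattice +
  assumes diff_closed: "\<lbrakk>x \<in> carrier S; y \<in> carrier S\<rbrakk> \<Longrightarrow> x \<setminus> y \<in> carrier S"
    and zero_closed: "\<zero> \<in> carrier S"
    and meet_join_distrib_left: "\<lbrakk>x \<in> carrier S; y \<in> carrier S; z \<in> carrier S\<rbrakk>
      \<Longrightarrow> x \<curlywedge> (y \<curlyvee> z) = (x \<curlywedge> y) \<curlyvee> (x \<curlywedge> z)"
    and meet_join_distrib_right: "\<lbrakk>x \<in> carrier S; y \<in> carrier S; z \<in> carrier S\<rbrakk>
      \<Longrightarrow> (x \<curlyvee> y) \<curlywedge> z = (x \<curlywedge> z) \<curlyvee> (y \<curlywedge> z)"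
    and zero_meet: "x \<in> carrier S \<Longrightarrow> \<zero> \<curlywedge> x = \<zero>"
    and meet_zero: "x \<in> carrier S \<Longrightarrow> x \<curlywedge> \<zero> = \<zero>"
    and zero_join: "x \<in> carrier S \<Longrightarrow> \<zero> \<curlyvee> x = x"
    and join_zero: "x \<in> carrier S \<Longrightarrow> x \<curlyvee> \<zero> = x"
    and diff_join: "\<lbrakk>x \<in> carrier S; y \<in> carrier S\<rbrakk>
      \<Longrightarrow> (x \<curlywedge> y \<curlywedge> x) \<curlyvee> (x \<setminus> y) = x"
    and meet_diff: "\<lbrakk>x \<in> carrier S; y \<in> carrier S\<rbrakk>
      \<Longrightarrow> (x \<curlywedge> y \<curlywedge> x) \<curlywedge> (x \<setminus> y) = \<zero>"
    and diff_meet: "\<lbrakk>x \<in> carrier S; y \<in> carrier S\<rbrakk>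
      \<Longrightarrow> (x \<setminus> y) \<curlywedge> (x \<curlywedge> y \<curlywedge> x) = \<zero>"

locale left_handed_skew_boolean_algebra = skew_boolean_algebra +
  assumes left_handed_meet: "\<lbrakk>x \<in> carrier S; y \<in> carrier S\<rbrakk> \<Longrightarrow> x \<curlywedge> y \<curlywedge> x = x \<curlywedge> y"
    and left_handed_join: "\<lbrakk>x \<in> carrier S; y \<in> carrier S\<rbrakk> \<Longrightarrow> x \<curlyvee> y \<curlyvee> x = y \<curlyvee> x"

text \<open>Homomorphisms are extensional (undefined outside the carrier), so that equality of
  homomorphisms is equality on the carrier and \<open>\<exists>!\<close> expresses uniqueness correctly.\<close>

definition skew_hom ::
    "('a, 'm) skew_algebra_scheme \<Rightarrow> ('b, 'n) skew_algebra_scheme \<Rightarrow> ('a \<Rightarrow> 'b) set" where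
  "skew_hom A B = {h \<in> carrier A \<rightarrow>\<^sub>E carrier B.
     (\<forall>x\<in>carrier A. \<forall>y\<in>carrier A.
        h (x \<curlywedge>\<^bsub>A\<^esub> y) = h x \<curlywedge>\<^bsub>B\<^esub> h y \<and>
        h (x \<curlyvee>\<^bsub>A\<^esub> y) = h x \<curlyvee>\<^bsub>B\<^esub> h y \<and>
        h (x \<setminus>\<^bsub>A\<^esub> y) = h x \<setminus>\<^bsub>B\<^esub> h y) \<and>
     h \<zero>\<^bsub>A\<^esub> = \<zero>\<^bsub>B\<^esub>}"

definition subuniverse :: "'a set \<Rightarrow> ('a, 'm) skew_algebra_scheme \<Rightarrow> bool" where
  "subuniverse H S \<longleftrightarrow> H \<subseteq> carrier S \<and> \<zero>\<^bsub>S\<^esub> \<in> H \<and>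
     (\<forall>x\<in>H. \<forall>y\<in>H. x \<curlywedge>\<^bsub>S\<^esub> y \<in> H \<and> x \<curlyvee>\<^bsub>S\<^esub> y \<in> H \<and> x \<setminus>\<^bsub>S\<^esub> y \<in> H)"

definition generated_subalgebra ::
    "('a, 'm) skew_algebra_scheme \<Rightarrow> 'a set \<Rightarrow> ('a, 'm) skew_algebra_scheme" where
  "generated_subalgebra S G = S\<lparr>carrier := \<Inter>{H. subuniverse H S \<and> G \<subseteq> H}\<rparr>"

text \<open>The target algebras range over all left-handed skew Boolean algebras whose carrier is a
  subset of the type \<open>'b\<close>. Freeness in the usual sense is this property for every type \<open>'b\<close>,
  which a theorem states by leaving \<open>'b\<close> as a type variable.\<close>

definition freely_generated ::
    "'b itself \<Rightarrow> ('a, 'm) skew_algebra_scheme \<Rightarrow> 'a set \<Rightarrow> bool" where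
  "freely_generated (_ :: 'b itself) A G \<longleftrightarrow>
     left_handed_skew_boolean_algebra A \<and> G \<subseteq> carrier A \<and>
     (\<forall>(B :: 'b skew_algebra) \<phi>.
        left_handed_skew_boolean_algebra B \<longrightarrow> \<phi> \<in> G \<rightarrow> carrier B \<longrightarrow>
        (\<exists>!h. h \<in> skew_hom A B \<and> (\<forall>g\<in>G. h g = \<phi> g)))"

definition nonzero_maps :: "'x set \<Rightarrow> ('x \<Rightarrow> nat) set" where
  "nonzero_maps X = (X \<rightarrow>\<^sub>E {0, 1}) - {\<lambda>x\<in>X. 0}"

definition Omega :: "'x set \<Rightarrow> (('x \<Rightarrow> nat) \<times> 'x) set" where
  "Omega X = {(f, x). f \<in> nonzero_maps X \<and> x \<in> X \<and> f x = 1}"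

text \<open>The projection \<open>p\<close> is \<^const>\<open>fst\<close>.\<close>

definition Omega_meet :: "('f \<times> 'x) set \<Rightarrow> ('f \<times> 'x) set \<Rightarrow> ('f \<times> 'x) set" where
  "Omega_meet A B = {(f, x) \<in> A. f \<in> fst ` A \<inter> fst ` B}"

definition Omega_diff :: "('f \<times> 'x) set \<Rightarrow> ('f \<times> 'x) set \<Rightarrow> ('f \<times> 'x) set" where
  "Omega_diff A B = {(f, x) \<in> A. f \<in> fst ` A - fst ` B}"

definition Omega_join :: "('f \<times> 'x) set \<Rightarrow> ('f \<times> 'x) set \<Rightarrow> ('f \<times> 'x) set" where
  "Omega_join A B = Omega_diff A B \<union> B"

definition S_Omega :: "'x set \<Rightarrow> (('x \<Rightarrow> nat) \<times> 'x) set skew_algebra" where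
  "S_Omega X = \<lparr>carrier = Pow (Omega X), sk_meet = Omega_meet, sk_join = Omega_join,
     sk_diff = Omega_diff, sk_zero = {}\<rparr>"

definition gen :: "'x set \<Rightarrow> 'x \<Rightarrow> (('x \<Rightarrow> nat) \<times> 'x) set" where
  "gen X x = {(f, x) | f. f \<in> nonzero_maps X \<and> f x = 1}"

definition S_free :: "'x set \<Rightarrow> (('x \<Rightarrow> nat) \<times> 'x) set skew_algebra" where
  "S_free X = generated_subalgebra (S_Omega X) (gen X ` X)"

lemma fst_Omega_ops:
  "fst ` Omega_meet A B = fst ` A \<inter> fst ` B"
  "fst ` Omega_diff A B = fst ` A - fst ` B"
  "fst ` Omega_join A B = fst ` A \<union> fst ` B"
proof -
  show "fst ` Omega_meet A B = fst ` A \<inter> fst ` B"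
    by (force simp: Omega_meet_def)
  show d: "fst ` Omega_diff A B = fst ` A - fst ` B"
    by (force simp: Omega_diff_def)
  show "fst ` Omega_join A B = fst ` A \<union> fst ` B"
    by (auto simp: Omega_join_def image_Un d)
qed

lemma mem_Omega_ops:
  "z \<in> Omega_meet A B \<longleftrightarrow> z \<in> A \<and> fst z \<in> fst ` B"
  "z \<in> Omega_diff A B \<longleftrightarrow> z \<in> A \<and> fst z \<notin> fst ` B"
  "z \<in> Omega_join A B \<longleftrightarrow> z \<in> A \<and> fst z \<notin> fst ` B \<or> z \<in> B"
  by (cases z; force simp: Omega_meet_def Omega_diff_def Omega_join_def)+

lemma S_Omega_left_handed_skew_boolean_algebra:
  "left_handed_skew_boolean_algebra (S_Omega X)"
proof -
  have im: "z \<in> A \<Longrightarrow> fst z \<in> fst ` A" for z :: "('x \<Rightarrow> nat) \<times> 'x" and A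
    by (rule imageI)
  show ?thesis
    by unfold_locales
      (simp_all only: S_Omega_def partial_object.simps skew_algebra.simps set_eq_iff subset_iff
        Pow_iff mem_Omega_ops fst_Omega_ops Un_iff Int_iff Diff_iff empty_iff image_empty,
       (blast intro: im)+)
qed

lemma gen_in_S_Omega: "x \<in> X \<Longrightarrow> gen X x \<in> carrier (S_Omega X)"
  by (auto simp: gen_def S_Omega_def Omega_def)

end

theory Submission
  imports Defs
begin

text \<open>
  Every element of \<open>\<langle>i(X)\<rangle>\<close> is the value of a term in the generators, so a map
  \<open>\<phi>\<close> from the generators to a left-handed skew Boolean algebra \<open>B\<close> can extend in at most one way:
  the value of a term in \<open>S\<^sub>\<Omega>\<close> must go to its value in \<open>B\<close>. The whole content of freeness is that this
  prescription is well defined, that is, that an equation between terms which holds for the generators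
  in \<open>S\<^sub>\<Omega>\<close> holds for every valuation in every \<open>B\<close>.

  Both sides are compared with the primitive algebras \<open>F \<union> {0}\<close>, in which a meet of
  non-zero elements is its left factor and a join of non-zero elements is its right factor. On the
  side of \<open>S\<^sub>\<Omega>\<close>, all operations act fibrewise over \<open>p\<close>, and over \<open>f\<close> the fibre
  computes in the primitive algebra on the support of \<open>f\<close>; hence an equation between terms that
  holds in \<open>S\<^sub>\<Omega>\<close> holds in all primitive algebras on subsets of \<open>X\<close> (lemma
  \<open>primitive_eq_if_S_Omega_eq\<close>).

  On the side of \<open>B\<close>, for each element \<open>c\<close> the maps \<open>x \<mapsto> x \<and> c\<close> and \<open>x \<mapsto> x \<setminus> c\<close> are endomorphisms,
  and together they determine \<open>x = (x \<and> c) \<or> (x \<setminus> c)\<close>. Applying this with \<open>c\<close> running through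
  the values of the finitely many variables of an equation splits the valuation into finitely many
  ones under which every variable is either zero or a right identity for the values of all
  variables. Such a valuation factors through a primitive algebra, so
  an equation that holds in the primitive algebras holds in \<open>B\<close> (lemma
  \<open>eval_eq_if_primitive_eq\<close>). This argument replaces the usual subdirect decomposition, and
  with it any choice of prime ideals.
\<close>

section \<open>Left-handed skew Boolean algebras\<close>

context left_handed_skew_boolean_algebra
begin

lemma subuniverse_carrier: "subuniverse (carrier S) S"
  by (simp add: subuniverse_def meet_closed join_closed diff_closed zero_closed)

lemma meet_idem: "x \<in> carrier S \<Longrightarrow> x \<curlywedge> x = x"
  by (metis join_absorb_left meet_absorb_left meet_closed)

lemma diff_decomp:
  assumes "x \<in> carrier S" "y \<in> carrier S"
  shows "(x \<curlywedge> y) \<curlyvee> (x \<setminus> y) = x"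
  using diff_join[OF assms] left_handed_meet[OF assms] by simp

lemma meet_diff_self:
  assumes "x \<in> carrier S" "y \<in> carrier S"
  shows "x \<curlywedge> (x \<setminus> y) = x \<setminus> y"
  using meet_absorb_right[of "x \<setminus> y" "x \<curlywedge> y"] assms
  by (simp add: diff_decomp meet_closed diff_closed)

lemma meet_eq_zero_commute:
  assumes "x \<in> carrier S" "y \<in> carrier S" "x \<curlywedge> y = \<zero>"
  shows "y \<curlywedge> x = \<zero>"
  using assms by (metis left_handed_meet meet_assoc meet_zero)

lemma diff_meet_zero:
  assumes x: "x \<in> carrier S" and y: "y \<in> carrier S"
  shows "(x \<setminus> y) \<curlywedge> y = \<zero>"
proof -
  have d: "x \<setminus> y \<in> carrier S" by (simp add: x y diff_closed)
  have "(x \<setminus> y) \<curlywedge> x = x \<setminus> y"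
    by (metis d x y left_handed_meet meet_assoc meet_diff_self meet_idem)
  then have "(x \<setminus> y) \<curlywedge> y = (x \<setminus> y) \<curlywedge> (x \<curlywedge> y)"
    by (metis d x y meet_assoc)
  also have "\<dots> = \<zero>"
    using diff_meet[OF x y] left_handed_meet[OF x y] by simp
  finally show ?thesis .
qed

lemma meet_diff_zero:
  assumes "x \<in> carrier S" "y \<in> carrier S"
  shows "y \<curlywedge> (x \<setminus> y) = \<zero>"
  using assms by (simp add: meet_eq_zero_commute diff_closed diff_meet_zero)

lemma meet_meet_zero:
  assumes "x \<in> carrier S" "y \<in> carrier S" "z \<in> carrier S" "x \<curlywedge> y = \<zero>"
  shows "x \<curlywedge> z \<curlywedge> y = \<zero>"
proof -
  have "x \<curlywedge> (z \<curlywedge> y) = x \<curlywedge> (z \<curlywedge> y) \<curlywedge> x"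
    using assms by (simp add: left_handed_meet meet_closed)
  also have "\<dots> = x \<curlywedge> (z \<curlywedge> (y \<curlywedge> x))"
    using assms by (simp add: meet_assoc meet_closed)
  also have "\<dots> = \<zero>"
    using assms by (simp add: meet_eq_zero_commute meet_zero)
  finally show ?thesis using assms by (simp add: meet_assoc)
qed

text \<open>Left normality. Split \<open>x\<close> into its parts below and off \<open>y\<close>: on the first part a further meet
  with \<open>y\<close> on the right changes nothing, and on the second part it gives zero.\<close>

lemma meet_right_commute:
  assumes x: "x \<in> carrier S" and y: "y \<in> carrier S" and z: "z \<in> carrier S"
  shows "x \<curlywedge> y \<curlywedge> z = x \<curlywedge> z \<curlywedge> y"
proof -
  have cl: "x \<curlywedge> y \<in> carrier S" "x \<setminus> y \<in> carrier S" "x \<curlywedge> y \<curlywedge> z \<in> carrier S"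
    "(x \<setminus> y) \<curlywedge> z \<in> carrier S"
    using x y z by (simp_all add: meet_closed diff_closed)
  have "x \<curlywedge> z \<curlywedge> y = ((x \<curlywedge> y) \<curlyvee> (x \<setminus> y)) \<curlywedge> z \<curlywedge> y"
    by (simp add: diff_decomp x y)
  also have "\<dots> = (x \<curlywedge> y \<curlywedge> z \<curlywedge> y) \<curlyvee> ((x \<setminus> y) \<curlywedge> z \<curlywedge> y)"
    using cl x y z by (simp add: meet_join_distrib_right)
  also have "(x \<setminus> y) \<curlywedge> z \<curlywedge> y = \<zero>"
    using cl x y z by (simp add: meet_meet_zero diff_meet_zero)
  also have "x \<curlywedge> y \<curlywedge> z \<curlywedge> y = x \<curlywedge> y \<curlywedge> z"
    by (metis left_handed_meet meet_assoc meet_closed x y z)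
  finally show ?thesis using cl by (simp add: join_zero)
qed

text \<open>Relative complements are unique: two candidates \<open>d\<close> and \<open>e\<close> satisfy \<open>e = d \<and> e\<close> and
  \<open>d = e \<and> d\<close>, which left-handedness turns into \<open>d = e\<close>. All identities for the difference
  below rest on this characterisation.\<close>

lemma diff_unique:
  assumes x: "x \<in> carrier S" and y: "y \<in> carrier S" and d: "d \<in> carrier S"
    and join: "(x \<curlywedge> y) \<curlyvee> d = x" and disj: "d \<curlywedge> y = \<zero>"
  shows "x \<setminus> y = d"
proof -
  let ?e = "x \<setminus> y"
  have e: "?e \<in> carrier S" and xy: "x \<curlywedge> y \<in> carrier S"
    using x y by (simp_all add: diff_closed meet_closed)
  have "?e = ((x \<curlywedge> y) \<curlyvee> d) \<curlywedge> ?e"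
    using meet_diff_self[OF x y] by (simp add: join)
  also have "\<dots> = (x \<curlywedge> (y \<curlywedge> ?e)) \<curlyvee> (d \<curlywedge> ?e)"
    using x y d e xy by (simp add: meet_join_distrib_right meet_assoc)
  also have "\<dots> = d \<curlywedge> ?e"
    using x y d e by (simp add: meet_diff_zero meet_zero zero_join meet_closed)
  finally have 1: "?e = d \<curlywedge> ?e" .
  have "d = x \<curlywedge> d"
    using meet_absorb_right[OF d xy] by (simp add: join)
  also have "\<dots> = ((x \<curlywedge> y) \<curlyvee> ?e) \<curlywedge> d"
    by (simp add: diff_decomp x y)
  also have "\<dots> = (x \<curlywedge> (y \<curlywedge> d)) \<curlyvee> (?e \<curlywedge> d)"
    using x y d e xy by (simp add: meet_join_distrib_right meet_assoc)
  also have "\<dots> = ?e \<curlywedge> d"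
    using x y d e disj by (simp add: meet_eq_zero_commute meet_zero zero_join meet_closed)
  finally have 2: "d = ?e \<curlywedge> d" .
  show ?thesis
    by (metis 1 2 d e left_handed_meet meet_assoc meet_idem)
qed

lemma diff_zero_left: "x \<in> carrier S \<Longrightarrow> \<zero> \<setminus> x = \<zero>"
  by (rule diff_unique) (simp_all add: zero_closed zero_meet zero_join)

lemma diff_zero_right: "x \<in> carrier S \<Longrightarrow> x \<setminus> \<zero> = x"
  by (rule diff_unique) (simp_all add: zero_closed meet_zero zero_join)

lemma diff_eq_zero:
  assumes "x \<in> carrier S" "y \<in> carrier S" "x \<curlywedge> y = x"
  shows "x \<setminus> y = \<zero>"
  using assms by (intro diff_unique) (simp_all add: zero_closed zero_meet join_zero)

text \<open>Distributing \<open>(a \<or> b) \<and> (b \<or> a)\<close> from the right gives \<open>a \<or> b\<close>, and distributing it from the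
  left gives \<open>b \<or> a\<close>.\<close>

lemma disjoint_join_commute:
  assumes a: "a \<in> carrier S" and b: "b \<in> carrier S" and ab: "a \<curlywedge> b = \<zero>"
  shows "a \<curlyvee> b = b \<curlyvee> a"
proof -
  have ba: "b \<curlywedge> a = \<zero>" using meet_eq_zero_commute[OF a b ab] .
  have ua: "(a \<curlyvee> b) \<curlywedge> a = a" and ub: "(a \<curlyvee> b) \<curlywedge> b = b"
    using a b by (simp_all add: meet_join_distrib_right ab ba meet_idem join_zero zero_join)
  have "(a \<curlyvee> b) \<curlywedge> (b \<curlyvee> a) = a \<curlyvee> b"
    using a b by (simp add: meet_join_distrib_left[of a] meet_join_distrib_left[of b]
        meet_join_distrib_right join_closed ab ba meet_idem join_zero zero_join)
  moreover have "(a \<curlyvee> b) \<curlywedge> (b \<curlyvee> a) = b \<curlyvee> a"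
    using a b by (simp add: meet_join_distrib_left join_closed ua ub)
  ultimately show ?thesis by simp
qed

lemma meet_right_hom:
  assumes c: "c \<in> carrier S"
  shows "(\<lambda>x\<in>carrier S. x \<curlywedge> c) \<in> skew_hom S S"
proof -
  have m: "x \<curlywedge> y \<curlywedge> c = (x \<curlywedge> c) \<curlywedge> (y \<curlywedge> c)"
    if x: "x \<in> carrier S" and y: "y \<in> carrier S" for x y
    using x y c by (metis meet_assoc meet_closed meet_idem meet_right_commute)
  have "x \<setminus> y \<curlywedge> c = (x \<curlywedge> c) \<setminus> (y \<curlywedge> c)"
    if x: "x \<in> carrier S" and y: "y \<in> carrier S" for x y
  proof (rule diff_unique[symmetric])
    have cl: "x \<setminus> y \<in> carrier S" "x \<curlywedge> y \<in> carrier S"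
      using x y by (simp_all add: meet_closed diff_closed)
    show "((x \<curlywedge> c) \<curlywedge> (y \<curlywedge> c)) \<curlyvee> (x \<setminus> y \<curlywedge> c) = x \<curlywedge> c"
      using cl x y c
      by (simp add: m[symmetric] meet_join_distrib_right[symmetric] diff_decomp)
    have "(x \<setminus> y \<curlywedge> c) \<curlywedge> (y \<curlywedge> c) = x \<setminus> y \<curlywedge> y \<curlywedge> c"
      using m[OF cl(1) y] by simp
    then show "(x \<setminus> y \<curlywedge> c) \<curlywedge> (y \<curlywedge> c) = \<zero>"
      using x y c by (simp add: diff_meet_zero zero_meet)
  qed (use x y c in \<open>simp_all add: meet_closed diff_closed\<close>)
  with m show ?thesis
    using c by (auto simp: skew_hom_def meet_closed join_closed diff_closed zero_closed
        zero_meet meet_join_distrib_right)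
qed

lemma diff_right_meet:
  assumes x: "x \<in> carrier S" and y: "y \<in> carrier S" and c: "c \<in> carrier S"
  shows "(x \<curlywedge> y) \<setminus> c = (x \<setminus> c) \<curlywedge> (y \<setminus> c)"
proof (rule diff_unique)
  have cl: "x \<setminus> c \<in> carrier S" "y \<setminus> c \<in> carrier S" "x \<curlywedge> c \<in> carrier S" "y \<curlywedge> c \<in> carrier S"
    using x y c by (simp_all add: meet_closed diff_closed)
  have z1: "(x \<curlywedge> c) \<curlywedge> (y \<setminus> c) = \<zero>"
    using x y c cl by (simp add: meet_assoc meet_diff_zero meet_zero)
  have z2: "(x \<setminus> c) \<curlywedge> (y \<curlywedge> c) = \<zero>"
    using x y c cl by (simp add: meet_assoc[symmetric] meet_meet_zero diff_meet_zero)
  have "x \<curlywedge> y = ((x \<curlywedge> c) \<curlyvee> (x \<setminus> c)) \<curlywedge> ((y \<curlywedge> c) \<curlyvee> (y \<setminus> c))"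
    by (simp add: diff_decomp x y c)
  also have "\<dots> = ((x \<curlywedge> c) \<curlywedge> (y \<curlywedge> c)) \<curlyvee> ((x \<setminus> c) \<curlywedge> (y \<setminus> c))"
    using cl by (simp add: meet_join_distrib_left meet_join_distrib_right z1 z2
        join_closed meet_closed join_zero zero_join)
  also have "(x \<curlywedge> c) \<curlywedge> (y \<curlywedge> c) = x \<curlywedge> y \<curlywedge> c"
    using x y c by (metis meet_assoc meet_closed meet_idem meet_right_commute)
  finally show "(x \<curlywedge> y \<curlywedge> c) \<curlyvee> ((x \<setminus> c) \<curlywedge> (y \<setminus> c)) = x \<curlywedge> y" by simp
  show "(x \<setminus> c) \<curlywedge> (y \<setminus> c) \<curlywedge> c = \<zero>"
    using x y c cl by (simp add: meet_assoc diff_meet_zero meet_zero)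
qed (use x y c in \<open>simp_all add: meet_closed diff_closed\<close>)

lemma diff_right_join:
  assumes x: "x \<in> carrier S" and y: "y \<in> carrier S" and c: "c \<in> carrier S"
  shows "(x \<curlyvee> y) \<setminus> c = (x \<setminus> c) \<curlyvee> (y \<setminus> c)"
proof (rule diff_unique)
  have cl: "x \<setminus> c \<in> carrier S" "y \<setminus> c \<in> carrier S" "x \<curlywedge> c \<in> carrier S" "y \<curlywedge> c \<in> carrier S"
    using x y c by (simp_all add: meet_closed diff_closed)
  have "(y \<curlywedge> c) \<curlywedge> (x \<setminus> c) = \<zero>"
    using x y c cl by (simp add: meet_assoc meet_diff_zero meet_zero)
  then have comm: "(y \<curlywedge> c) \<curlyvee> (x \<setminus> c) = (x \<setminus> c) \<curlyvee> (y \<curlywedge> c)"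
    using cl by (simp add: disjoint_join_commute)
  have "((x \<curlyvee> y) \<curlywedge> c) \<curlyvee> ((x \<setminus> c) \<curlyvee> (y \<setminus> c))
      = (x \<curlywedge> c) \<curlyvee> ((y \<curlywedge> c) \<curlyvee> (x \<setminus> c)) \<curlyvee> (y \<setminus> c)"
    using x y c cl by (simp add: meet_join_distrib_right join_assoc join_closed)
  also have "\<dots> = ((x \<curlywedge> c) \<curlyvee> (x \<setminus> c)) \<curlyvee> ((y \<curlywedge> c) \<curlyvee> (y \<setminus> c))"
    using cl by (simp add: comm join_assoc join_closed)
  finally show "((x \<curlyvee> y) \<curlywedge> c) \<curlyvee> ((x \<setminus> c) \<curlyvee> (y \<setminus> c)) = x \<curlyvee> y"
    by (simp add: diff_decomp x y c)
  show "((x \<setminus> c) \<curlyvee> (y \<setminus> c)) \<curlywedge> c = \<zero>"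
    using x y c cl by (simp add: meet_join_distrib_right diff_meet_zero zero_join zero_closed)
qed (use x y c in \<open>simp_all add: join_closed diff_closed\<close>)

lemma diff_right_hom:
  assumes c: "c \<in> carrier S"
  shows "(\<lambda>x\<in>carrier S. x \<setminus> c) \<in> skew_hom S S"
proof -
  have "x \<setminus> y \<setminus> c = (x \<setminus> c) \<setminus> (y \<setminus> c)" if x: "x \<in> carrier S" and y: "y \<in> carrier S" for x y
  proof (rule diff_unique[symmetric])
    have cl: "x \<setminus> y \<in> carrier S" "x \<curlywedge> y \<in> carrier S"
      using x y by (simp_all add: meet_closed diff_closed)
    show "((x \<setminus> c) \<curlywedge> (y \<setminus> c)) \<curlyvee> (x \<setminus> y \<setminus> c) = x \<setminus> c"
      using x y c cl
      by (simp add: diff_right_meet[symmetric] diff_right_join[symmetric] diff_decomp)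
    show "(x \<setminus> y \<setminus> c) \<curlywedge> (y \<setminus> c) = \<zero>"
      using x y c cl
      by (simp add: diff_right_meet[symmetric] diff_meet_zero diff_zero_left)
  qed (use x y c in \<open>simp_all add: diff_closed\<close>)
  then show ?thesis
    using c by (auto simp: skew_hom_def meet_closed join_closed diff_closed zero_closed
        diff_zero_left diff_right_meet diff_right_join)
qed

lemma eq_if_meet_eq_and_diff_eq:
  assumes "x \<in> carrier S" "y \<in> carrier S" "c \<in> carrier S" "x \<curlywedge> c = y \<curlywedge> c" "x \<setminus> c = y \<setminus> c"
  shows "x = y"
  using assms by (metis diff_decomp)

end

lemma left_handed_skew_boolean_algebra_subuniverse:
  assumes "left_handed_skew_boolean_algebra S" and "subuniverse H S"
  shows "left_handed_skew_boolean_algebra (S\<lparr>carrier := H\<rparr>)"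
proof -
  interpret left_handed_skew_boolean_algebra S by fact
  have sub: "x \<in> H \<Longrightarrow> x \<in> carrier S" for x
    using assms(2) by (auto simp: subuniverse_def)
  have cl: "\<zero>\<^bsub>S\<^esub> \<in> H" "\<And>x y. x \<in> H \<Longrightarrow> y \<in> H \<Longrightarrow> x \<curlywedge>\<^bsub>S\<^esub> y \<in> H"
    "\<And>x y. x \<in> H \<Longrightarrow> y \<in> H \<Longrightarrow> x \<curlyvee>\<^bsub>S\<^esub> y \<in> H" "\<And>x y. x \<in> H \<Longrightarrow> y \<in> H \<Longrightarrow> x \<setminus>\<^bsub>S\<^esub> y \<in> H"
    using assms(2) by (auto simp: subuniverse_def)
  show ?thesis
    by unfold_locales
      (simp_all add: sub cl meet_absorb_left meet_absorb_right join_absorb_left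
        join_absorb_right meet_join_distrib_left meet_join_distrib_right zero_meet meet_zero
        zero_join join_zero diff_join meet_diff diff_meet,
       simp_all add: sub left_handed_meet left_handed_join,
       simp_all add: sub meet_assoc join_assoc)
qed

section \<open>Terms and free generation\<close>

datatype (vars: 'x) skew_term =
    Var 'x
  | Zero
  | Meet "'x skew_term" "'x skew_term"
  | Join "'x skew_term" "'x skew_term"
  | Diff "'x skew_term" "'x skew_term"

primrec eval :: "('a, 'm) skew_algebra_scheme \<Rightarrow> ('x \<Rightarrow> 'a) \<Rightarrow> 'x skew_term \<Rightarrow> 'a" where
  "eval A \<phi> (Var x) = \<phi> x"
| "eval A \<phi> Zero = \<zero>\<^bsub>A\<^esub>"
| "eval A \<phi> (Meet s t) = eval A \<phi> s \<curlywedge>\<^bsub>A\<^esub> eval A \<phi> t"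
| "eval A \<phi> (Join s t) = eval A \<phi> s \<curlyvee>\<^bsub>A\<^esub> eval A \<phi> t"
| "eval A \<phi> (Diff s t) = eval A \<phi> s \<setminus>\<^bsub>A\<^esub> eval A \<phi> t"

lemma eval_in_subuniverse:
  assumes "subuniverse H A" and "\<phi> \<in> vars t \<rightarrow> H"
  shows "eval A \<phi> t \<in> H"
  using assms(2) by (induction t) (use assms(1) in \<open>auto simp: subuniverse_def\<close>)

lemma eval_hom:
  assumes h: "h \<in> skew_hom A B" and A: "subuniverse (carrier A) A"
    and "\<phi> \<in> vars t \<rightarrow> carrier A"
  shows "h (eval A \<phi> t) = eval B (\<lambda>x. h (\<phi> x)) t"
proof -
  have "eval A \<phi> s \<in> carrier A" if "vars s \<subseteq> vars t" for s
    using assms(3) that by (intro eval_in_subuniverse[OF A]) auto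
  moreover have "vars s \<subseteq> vars t \<Longrightarrow> h (eval A \<phi> s) = eval B (\<lambda>x. h (\<phi> x)) s" for s
    by (induction s) (use h calculation in \<open>auto simp: skew_hom_def\<close>)
  ultimately show ?thesis by simp
qed

lemma eval_cong:
  "(\<And>x. x \<in> vars t \<Longrightarrow> \<phi> x = \<psi> x) \<Longrightarrow> eval A \<phi> t = eval A \<psi> t"
  by (induction t) auto

lemma generated_subalgebra_carrier:
  assumes A: "subuniverse (carrier A) A" and i: "i \<in> X \<rightarrow> carrier A"
  shows "carrier (generated_subalgebra A (i ` X)) = {eval A i t |t. vars t \<subseteq> X}"
proof -
  let ?E = "{eval A i t |t. vars t \<subseteq> X}"
  have ops: "\<exists>u. eval A i s \<curlywedge>\<^bsub>A\<^esub> eval A i t = eval A i u \<and> vars u \<subseteq> X"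
    "\<exists>u. eval A i s \<curlyvee>\<^bsub>A\<^esub> eval A i t = eval A i u \<and> vars u \<subseteq> X"
    "\<exists>u. eval A i s \<setminus>\<^bsub>A\<^esub> eval A i t = eval A i u \<and> vars u \<subseteq> X"
    if "vars s \<subseteq> X" "vars t \<subseteq> X" for s t
    by (rule exI[of _ "Meet s t"] exI[of _ "Join s t"] exI[of _ "Diff s t"]; use that in simp)+
  have zero: "\<exists>u. \<zero>\<^bsub>A\<^esub> = eval A i u \<and> vars u \<subseteq> X"
    by (rule exI[of _ Zero]) simp
  have "?E \<subseteq> carrier A"
    using i by (auto intro!: eval_in_subuniverse[OF A])
  then have "subuniverse ?E A"
    using ops zero by (auto simp: subuniverse_def)
  moreover have "i ` X \<subseteq> ?E"
    by (auto intro!: exI[of _ "Var _"])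
  moreover have "eval A i t \<in> H" if "subuniverse H A" "i ` X \<subseteq> H" "vars t \<subseteq> X" for H t
    using that by (intro eval_in_subuniverse) auto
  ultimately show ?thesis
    unfolding generated_subalgebra_def by auto
qed

text \<open>The construction of the extension: the value of a term in \<open>A\<close> is sent to its value in \<open>B\<close>.
  The last hypothesis makes the choice of the term irrelevant.\<close>

lemma freely_generatedI:
  fixes A :: "('a, 'm) skew_algebra_scheme" and i :: "'x \<Rightarrow> 'a"
  assumes A: "left_handed_skew_boolean_algebra A"
    and i: "i \<in> X \<rightarrow> carrier A" and inj: "inj_on i X"
    and eq: "\<And>(B :: 'b skew_algebra) \<phi> s t. \<lbrakk>left_handed_skew_boolean_algebra B;
      \<phi> \<in> X \<rightarrow> carrier B; vars s \<subseteq> X; vars t \<subseteq> X; eval A i s = eval A i t\<rbrakk>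
      \<Longrightarrow> eval B \<phi> s = eval B \<phi> t"
  shows "freely_generated TYPE('b) (generated_subalgebra A (i ` X)) (i ` X)"
proof -
  interpret A: left_handed_skew_boolean_algebra A by fact
  let ?G = "generated_subalgebra A (i ` X)"
  note carG = generated_subalgebra_carrier[OF A.subuniverse_carrier i]
  have G_ops: "sk_meet ?G = sk_meet A" "sk_join ?G = sk_join A" "sk_diff ?G = sk_diff A"
    "sk_zero ?G = sk_zero A"
    by (simp_all add: generated_subalgebra_def)
  have sub: "subuniverse (carrier ?G) A"
  proof -
    have "carrier ?G \<subseteq> carrier A"
      using A.subuniverse_carrier i by (auto simp: generated_subalgebra_def)
    then show ?thesis
      by (simp add: generated_subalgebra_def subuniverse_def)
  qed
  have G: "left_handed_skew_boolean_algebra ?G"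
    using left_handed_skew_boolean_algebra_subuniverse[OF A sub]
    by (simp add: generated_subalgebra_def)
  then have subG: "subuniverse (carrier ?G) ?G"
    by (rule left_handed_skew_boolean_algebra.subuniverse_carrier)
  have gens: "i ` X \<subseteq> carrier ?G"
    by (auto simp: generated_subalgebra_def)
  have evalG: "eval ?G i t = eval A i t" for t
    by (induction t) (simp_all add: G_ops)
  have "\<exists>!h. h \<in> skew_hom ?G B \<and> (\<forall>g\<in>i ` X. h g = \<phi> g)"
    if B: "left_handed_skew_boolean_algebra B" and \<phi>: "\<phi> \<in> i ` X \<rightarrow> carrier B"
    for B :: "'b skew_algebra" and \<phi>
  proof -
    interpret B: left_handed_skew_boolean_algebra B by fact
    have \<phi>i: "(\<lambda>x. \<phi> (i x)) \<in> X \<rightarrow> carrier B" using \<phi> by auto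
    let ?e = "eval B (\<lambda>x. \<phi> (i x))"
    have e_closed: "?e t \<in> carrier B" if "vars t \<subseteq> X" for t
      using that \<phi>i by (intro eval_in_subuniverse[OF B.subuniverse_carrier]) auto
    define h where
      "h = (\<lambda>a\<in>carrier ?G. ?e (SOME t. vars t \<subseteq> X \<and> eval A i t = a))"
    have h_eval: "h (eval A i t) = ?e t" if t: "vars t \<subseteq> X" for t
    proof -
      let ?s = "SOME s. vars s \<subseteq> X \<and> eval A i s = eval A i t"
      have s: "vars ?s \<subseteq> X \<and> eval A i ?s = eval A i t"
        by (rule someI[of _ t]) (use t in simp)
      have "h (eval A i t) = ?e ?s"
        using t by (auto simp: h_def carG)
      also have "\<dots> = ?e t"
        using eq[OF B \<phi>i] s t by blast
      finally show ?thesis .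
    qed
    have h_ops: "h (a \<curlywedge>\<^bsub>A\<^esub> b) = h a \<curlywedge>\<^bsub>B\<^esub> h b" "h (a \<curlyvee>\<^bsub>A\<^esub> b) = h a \<curlyvee>\<^bsub>B\<^esub> h b"
      "h (a \<setminus>\<^bsub>A\<^esub> b) = h a \<setminus>\<^bsub>B\<^esub> h b" if a: "a \<in> carrier ?G" and b: "b \<in> carrier ?G" for a b
    proof -
      obtain s t where st: "vars s \<subseteq> X" "a = eval A i s" "vars t \<subseteq> X" "b = eval A i t"
        using a b by (auto simp: carG)
      show "h (a \<curlywedge>\<^bsub>A\<^esub> b) = h a \<curlywedge>\<^bsub>B\<^esub> h b" "h (a \<curlyvee>\<^bsub>A\<^esub> b) = h a \<curlyvee>\<^bsub>B\<^esub> h b"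
        "h (a \<setminus>\<^bsub>A\<^esub> b) = h a \<setminus>\<^bsub>B\<^esub> h b"
        using h_eval[of "Meet s t"] h_eval[of "Join s t"] h_eval[of "Diff s t"] st
        by (simp_all add: h_eval)
    qed
    have "h \<in> carrier ?G \<rightarrow> carrier B"
      using e_closed h_eval by (auto simp: carG)
    then have "h \<in> carrier ?G \<rightarrow>\<^sub>E carrier B"
      by (simp add: PiE_def h_def)
    then have h_hom: "h \<in> skew_hom ?G B"
      using h_ops h_eval[of Zero] by (simp add: skew_hom_def G_ops)
    have h_gen: "\<forall>g\<in>i ` X. h g = \<phi> g"
      using h_eval[of "Var _"] by simp
    have unique: "h1 = h2"
      if h1: "h1 \<in> skew_hom ?G B" "\<forall>g\<in>i ` X. h1 g = \<phi> g"
        and h2: "h2 \<in> skew_hom ?G B" "\<forall>g\<in>i ` X. h2 g = \<phi> g" for h1 h2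
    proof (rule extensionalityI)
      show "h1 \<in> extensional (carrier ?G)" "h2 \<in> extensional (carrier ?G)"
        using h1(1) h2(1) by (auto simp: skew_hom_def PiE_def)
      fix a assume "a \<in> carrier ?G"
      then obtain t where t: "vars t \<subseteq> X" "a = eval ?G i t"
        by (auto simp: carG evalG)
      have it: "i \<in> vars t \<rightarrow> carrier ?G"
        using t(1) gens by auto
      show "h1 a = h2 a"
        unfolding t(2) eval_hom[OF h1(1) subG it] eval_hom[OF h2(1) subG it]
        by (rule eval_cong) (use h1(2) h2(2) t(1) in auto)
    qed
    show ?thesis
      using h_hom h_gen unique by (intro ex1I[of _ h]) auto
  qed
  with G gens show ?thesis
    by (auto simp: freely_generated_def)
qed

section \<open>Primitive algebras\<close>

text \<open>The left-handed skew Boolean algebra whose non-zero elements form a single \<open>\<D>\<close>-class \<open>F\<close>;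
  \<open>None\<close> is its zero.\<close>

definition primitive :: "'x set \<Rightarrow> 'x option skew_algebra" where
  "primitive F = \<lparr>carrier = insert None (Some ` F),
     sk_meet = (\<lambda>a b. if b = None then None else a),
     sk_join = (\<lambda>a b. if b = None then a else b),
     sk_diff = (\<lambda>a b. if b = None then a else None),
     sk_zero = None\<rparr>"

definition primitive_val :: "'x set \<Rightarrow> 'x \<Rightarrow> 'x option" where
  "primitive_val F x = (if x \<in> F then Some x else None)"

lemma subuniverse_primitive: "subuniverse (carrier (primitive F)) (primitive F)"
  by (auto simp: subuniverse_def primitive_def)

context left_handed_skew_boolean_algebra
begin

text \<open>The condition on \<open>\<phi>\<close> says that its non-zero values lie in one \<open>\<D>\<close>-class, that
  is, that they form a primitive subalgebra together with zero.\<close>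

lemma eval_factors_through_primitive:
  assumes V: "vars t \<subseteq> V" "\<phi> \<in> V \<rightarrow> carrier S"
    and flat: "\<And>z w. \<lbrakk>z \<in> V; \<phi> z \<noteq> \<zero>; w \<in> V\<rbrakk> \<Longrightarrow> \<phi> w \<curlywedge> \<phi> z = \<phi> w"
    and F: "F = {z \<in> V. \<phi> z \<noteq> \<zero>}"
  shows "eval S \<phi> t = case_option \<zero> \<phi> (eval (primitive F) (primitive_val F) t)"
proof -
  let ?P = "primitive F"
  define h where "h = (\<lambda>a\<in>carrier ?P. case_option \<zero> \<phi> a)"
  have join: "\<phi> w \<curlyvee> \<phi> z = \<phi> z" and diff: "\<phi> w \<setminus> \<phi> z = \<zero>" if "z \<in> F" "w \<in> F" for z w
    using flat[of z w] join_absorb_right[of "\<phi> z" "\<phi> w"] diff_eq_zero[of "\<phi> w" "\<phi> z"] that V(2)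
    by (auto simp: F Pi_iff)
  have h: "h \<in> skew_hom ?P S"
    using V(2) flat join diff
    by (auto simp: h_def skew_hom_def primitive_def F Pi_iff zero_closed meet_zero zero_meet
        join_zero zero_join diff_zero_left diff_zero_right meet_idem)
  have val: "primitive_val F \<in> vars t \<rightarrow> carrier ?P"
    by (auto simp: primitive_val_def primitive_def)
  have "eval S \<phi> t = eval S (\<lambda>x. h (primitive_val F x)) t"
    by (rule eval_cong) (use V in \<open>auto simp: h_def primitive_val_def primitive_def F\<close>)
  also have "\<dots> = h (eval ?P (primitive_val F) t)"
    by (rule eval_hom[OF h subuniverse_primitive val, symmetric])
  also have "\<dots> = case_option \<zero> \<phi> (eval ?P (primitive_val F) t)"
    unfolding h_def using eval_in_subuniverse[OF subuniverse_primitive val] by simp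
  finally show ?thesis .
qed

text \<open>Induction on the set \<open>U\<close> of variables whose values are still unrestricted. A
  variable \<open>y \<in> U\<close> is removed by passing to the two valuations \<open>x \<mapsto> \<phi> x \<and> \<phi> y\<close> and
  \<open>x \<mapsto> \<phi> x \<setminus> \<phi> y\<close>: they make \<open>y\<close> a right identity and zero respectively, and as
  they are obtained by applying endomorphisms, they preserve what was achieved for
  the other variables.\<close>

lemma eval_eq_if_primitive_eq:
  assumes \<phi>: "\<phi> \<in> vars s \<union> vars t \<rightarrow> carrier S"
    and eq: "\<And>F. F \<subseteq> vars s \<union> vars t \<Longrightarrow>
      eval (primitive F) (primitive_val F) s = eval (primitive F) (primitive_val F) t"
  shows "eval S \<phi> s = eval S \<phi> t"
proof -
  let ?V = "vars s \<union> vars t"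
  have fin: "finite (vars u)" for u :: "'c skew_term" by (induction u) auto
  have main: "eval S \<phi> s = eval S \<phi> t"
    if "finite U" "\<phi> \<in> ?V \<rightarrow> carrier S"
      "\<And>z w. \<lbrakk>z \<in> ?V - U; \<phi> z \<noteq> \<zero>; w \<in> ?V\<rbrakk> \<Longrightarrow> \<phi> w \<curlywedge> \<phi> z = \<phi> w" for U \<phi>
    using that
  proof (induction U arbitrary: \<phi> rule: finite_induct)
    case empty
    define F where "F = {z \<in> ?V. \<phi> z \<noteq> \<zero>}"
    have "eval S \<phi> u = case_option \<zero> \<phi> (eval (primitive F) (primitive_val F) u)"
      if "vars u \<subseteq> ?V" for u
      by (rule eval_factors_through_primitive[where V = ?V])
        (use empty that in \<open>auto simp: F_def\<close>)
    moreover have "F \<subseteq> ?V" by (auto simp: F_def)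
    ultimately show ?case using eq[of F] by simp
  next
    case (insert y U)
    show ?case
    proof (cases "y \<in> ?V")
      case False
      then show ?thesis using insert.prems by (intro insert.IH) auto
    next
      case y: True
      define c where "c = \<phi> y"
      have c: "c \<in> carrier S" using insert.prems(1) y by (auto simp: c_def)
      have \<phi>: "\<phi> x \<in> carrier S" if "x \<in> ?V" for x using insert.prems(1) that by blast
      have apply_hom: "h (eval S \<phi> s) = h (eval S \<phi> t)"
        if h: "h \<in> skew_hom S S"
          and hy: "h c = \<zero> \<or> (\<forall>x\<in>carrier S. h x \<curlywedge> h c = h x)" for h
      proof -
        have hcl: "h a \<in> carrier S" and hmeet: "h (a \<curlywedge> b) = h a \<curlywedge> h b" and h0: "h \<zero> = \<zero>"
          if "a \<in> carrier S" "b \<in> carrier S" for a b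
          using h that by (auto simp: skew_hom_def)
        have "eval S (\<lambda>x. h (\<phi> x)) s = eval S (\<lambda>x. h (\<phi> x)) t"
        proof (rule insert.IH)
          show "(\<lambda>x. h (\<phi> x)) \<in> ?V \<rightarrow> carrier S" using \<phi> hcl by blast
          fix z w assume z: "z \<in> ?V - U" "h (\<phi> z) \<noteq> \<zero>" and w: "w \<in> ?V"
          show "h (\<phi> w) \<curlywedge> h (\<phi> z) = h (\<phi> w)"
          proof (cases "z = y")
            case True
            then show ?thesis using hy z(2) \<phi>[OF w] by (simp add: c_def)
          next
            case False
            have "\<phi> z \<noteq> \<zero>" using z(2) h0[OF zero_closed zero_closed] by auto
            then have "\<phi> w \<curlywedge> \<phi> z = \<phi> w" using insert.prems(2)[of z w] z(1) w False by auto
            then show ?thesis using hmeet[of "\<phi> w" "\<phi> z"] \<phi> z(1) w by simp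
          qed
        qed
        moreover have "h (eval S \<phi> u) = eval S (\<lambda>x. h (\<phi> x)) u" if "vars u \<subseteq> ?V" for u
          by (rule eval_hom[OF h subuniverse_carrier]) (use \<phi> that in auto)
        ultimately show ?thesis by simp
      qed
      have e: "eval S \<phi> s \<in> carrier S" "eval S \<phi> t \<in> carrier S"
        using \<phi> by (auto intro!: eval_in_subuniverse[OF subuniverse_carrier])
      have "eval S \<phi> s \<curlywedge> c = eval S \<phi> t \<curlywedge> c"
        using apply_hom[OF meet_right_hom[OF c]] e c
        by (simp add: meet_idem meet_assoc meet_closed)
      moreover have "eval S \<phi> s \<setminus> c = eval S \<phi> t \<setminus> c"
        using apply_hom[OF diff_right_hom[OF c]] e c
        by (simp add: diff_eq_zero meet_idem)
      ultimately show ?thesis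
        using eq_if_meet_eq_and_diff_eq[OF e c] by simp
    qed
  qed
  show ?thesis
    by (rule main[of ?V]) (use \<phi> in \<open>auto simp: fin\<close>)
qed

end

section \<open>The fibres of the algebra of subsets\<close>

lemma inj_on_gen: "inj_on (gen X) X"
proof (rule inj_onI)
  fix x y assume x: "x \<in> X" and eq: "gen X x = gen X y"
  let ?f = "\<lambda>z\<in>X. if z = x then 1 else (0::nat)"
  have "?f \<in> nonzero_maps X"
    using x by (auto simp: nonzero_maps_def dest: fun_cong[of _ _ x])
  then have "(?f, x) \<in> gen X x" using x by (simp add: gen_def)
  then show "x = y" by (simp add: eq) (simp add: gen_def)
qed

lemma eval_S_Omega_fibrewise:
  assumes "vars t \<subseteq> X"
  shows "eval (S_Omega X) (gen X) t = {(f, x). f \<in> nonzero_maps X \<and>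
    eval (primitive {y \<in> X. f y = 1}) (primitive_val {y \<in> X. f y = 1}) t = Some x}"
  using assms
proof (induction t)
  case (Var x)
  then show ?case by (auto simp: gen_def primitive_val_def split: if_splits)
next
  case Zero
  show ?case by (simp add: S_Omega_def primitive_def)
next
  case (Meet s t)
  then show ?case
    by (auto simp: S_Omega_def primitive_def mem_Omega_ops image_iff split: if_splits)
next
  case (Join s t)
  then show ?case
    by (auto simp: S_Omega_def primitive_def mem_Omega_ops image_iff split: if_splits)
next
  case (Diff s t)
  then show ?case
    by (auto simp: S_Omega_def primitive_def mem_Omega_ops image_iff split: if_splits)
qed

text \<open>A non-empty \<open>F\<close> is the support of a point \<open>f\<close> of the base, and the fibre over \<open>f\<close> can be
  read off from the values in \<open>S\<^sub>\<Omega>\<close>. The empty set is the support of the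
  excluded zero map, but there every term has the value zero.\<close>

lemma primitive_eq_if_S_Omega_eq:
  assumes vars: "vars s \<subseteq> X" "vars t \<subseteq> X" and F: "F \<subseteq> X"
    and eq: "eval (S_Omega X) (gen X) s = eval (S_Omega X) (gen X) t"
  shows "eval (primitive F) (primitive_val F) s = eval (primitive F) (primitive_val F) t"
proof (cases "F = {}")
  case True
  have "eval (primitive {}) (primitive_val {}) u = None" for u :: "'a skew_term"
    by (induction u) (simp_all add: primitive_def primitive_val_def)
  then show ?thesis by (simp add: True)
next
  case False
  define f where "f = (\<lambda>x\<in>X. if x \<in> F then 1 else (0::nat))"
  obtain z where z: "z \<in> F" using False by blast
  then have "f z \<noteq> (\<lambda>x\<in>X. 0::nat) z" using F by (auto simp: f_def)
  then have "f \<noteq> (\<lambda>x\<in>X. 0)" by blast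
  moreover have "f \<in> X \<rightarrow>\<^sub>E {0, 1}" by (auto simp: f_def)
  ultimately have f: "f \<in> nonzero_maps X" by (simp add: nonzero_maps_def)
  have supp: "{y \<in> X. f y = 1} = F" using F by (auto simp: f_def)
  have "(f, x) \<in> eval (S_Omega X) (gen X) u \<longleftrightarrow>
      eval (primitive F) (primitive_val F) u = Some x" if "vars u \<subseteq> X" for u x
    using f by (simp add: eval_S_Omega_fibrewise[OF that] supp[simplified])
  then show ?thesis using vars eq by (metis option.exhaust)
qed

theorem theorem6p9:
  fixes X :: "'x set"
  assumes "X \<noteq> {}"
  shows "freely_generated TYPE('b) (S_free X) (gen X ` X)"
  unfolding S_free_def
proof (rule freely_generatedI)
  show "left_handed_skew_boolean_algebra (S_Omega X)"
    by (rule S_Omega_left_handed_skew_boolean_algebra)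
  show "gen X \<in> X \<rightarrow> carrier (S_Omega X)"
    by (simp add: gen_in_S_Omega)
  show "inj_on (gen X) X" by (rule inj_on_gen)
  fix B :: "'b skew_algebra" and \<phi> s t
  assume B: "left_handed_skew_boolean_algebra B" and \<phi>: "\<phi> \<in> X \<rightarrow> carrier B"
    and st: "vars s \<subseteq> X" "vars t \<subseteq> X" "eval (S_Omega X) (gen X) s = eval (S_Omega X) (gen X) t"
  show "eval B \<phi> s = eval B \<phi> t"
  proof (rule left_handed_skew_boolean_algebra.eval_eq_if_primitive_eq[OF B])
    show "\<phi> \<in> vars s \<union> vars t \<rightarrow> carrier B" using \<phi> st by blast
    fix F assume "F \<subseteq> vars s \<union> vars t"
    then show "eval (primitive F) (primitive_val F) s = eval (primitive F) (primitive_val F) t"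
      using st by (intro primitive_eq_if_S_Omega_eq) auto
  qed
qed

end
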